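(* Let $n \in \mathbb{N}$ and let $\mathcal{F} \subseteq \mathcal{P}([n])$ be a nontrivial, union closed family. Then there is an up-set $\mathcal{U} \subseteq \mathcal{P}([n])$ with $\#\mathcal{U} \leq 2^{n-1}$ such that $$\#(\mathcal{F} \cap \mathcal{U}) \geq \frac{1}{2} \cdot \#\mathcal{F}.$$ *)

theory Defs
  imports Complex_Main
begin

definition union_closed :: "'a set set \<Rightarrow> bool" where
  "union_closed F \<longleftrightarrow> (\<forall>A\<in>F. \<forall>B\<in>F. A \<union> B \<in> F)"

definition nontrivial :: "'a set set \<Rightarrow> bool" where
  "nontrivial F \<longleftrightarrow> F \<noteq> {} \<and> F \<noteq> {{}}"

definition up_set :: "'a set \<Rightarrow> 'a set set \<Rightarrow> bool" where
  "up_set X U \<longleftrightarrow> U \<subseteq> Pow X \<and> (\<forall>A\<in>U. \<forall>B. A \<subseteq> B \<and> B \<subseteq> X \<longrightarrow> B \<in> U)"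

end

theory Submission
  imports Defs "HOL-Library.Nat_Bijection"
begin

text \<open>
  Put \<open>F' = F \<union> {\<emptyset>}\<close> and send every \<open>Y\<close> to its kernel, the largest member of \<open>F'\<close> contained
  in \<open>Y\<close>. Picking from each fibre of this map the member with the largest binary code gives an
  up-set \<open>G\<close> with \<open>|G| = |F'|\<close>. If \<open>C\<close> is an up-set of the poset \<open>F'\<close> and \<open>U\<close> consists of the sets
  with kernel in \<open>C\<close>, then \<open>U\<close> is an up-set with \<open>F' \<inter> U = C\<close> and \<open>|G \<inter> U| = |C|\<close>, so Kleitman's
  correlation inequality bounds \<open>|U|\<close> by \<open>2^n |C| / |F'|\<close>. With \<open>|C| = |F'| / 2\<close> this is the claim
  when \<open>|F'|\<close> is even. When \<open>|F'|\<close> is odd one must take \<open>|C| = (|F'| + 1) / 2\<close>, and the rounding loss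
  is exactly compensated by an extra term in Kleitman's inequality, available because an up-set
  of odd size depends on every coordinate.
\<close>

section \<open>Finite up-sets and Kleitman's inequality with a parity term\<close>

lemma card_split_element:
  assumes "finite X" "x \<notin> X" "S \<subseteq> Pow (insert x X)"
  shows "card S = card (S \<inter> Pow X) + card {A \<in> Pow X. insert x A \<in> S}"
proof -
  let ?S1 = "{A \<in> Pow X. insert x A \<in> S}"
  have "S = (S \<inter> Pow X) \<union> insert x ` ?S1"
  proof (intro equalityI subsetI)
    fix A assume A: "A \<in> S"
    show "A \<in> (S \<inter> Pow X) \<union> insert x ` ?S1"
    proof (cases "x \<in> A")
      case True
      then have "A = insert x (A - {x})" "A - {x} \<in> ?S1"
        using A assms(3) by (auto simp: insert_absorb)
      then show ?thesis by blast
    next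
      case False
      then show ?thesis using A assms(3) by blast
    qed
  qed auto
  moreover have "card (insert x ` ?S1) = card ?S1"
    by (rule card_image) (use assms(2) in \<open>auto simp: inj_on_def\<close>)
  moreover have "(S \<inter> Pow X) \<inter> insert x ` ?S1 = {}"
    using assms(2) by auto
  moreover have "finite (S \<inter> Pow X)" "finite (insert x ` ?S1)"
    using assms(1) by auto
  ultimately show ?thesis
    by (metis card_Un_disjoint)
qed

lemma up_setI:
  assumes "U \<subseteq> Pow X" "\<And>A B. A \<in> U \<Longrightarrow> A \<subseteq> B \<Longrightarrow> B \<subseteq> X \<Longrightarrow> B \<in> U"
  shows "up_set X U"
  using assms unfolding up_set_def by simp

lemma up_setD: "up_set X U \<Longrightarrow> A \<in> U \<Longrightarrow> A \<subseteq> B \<Longrightarrow> B \<subseteq> X \<Longrightarrow> B \<in> U"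
  unfolding up_set_def by blast

lemma up_set_Int:
  assumes "up_set X U" "up_set X V"
  shows "up_set X (U \<inter> V)"
proof (rule up_setI)
  show "U \<inter> V \<subseteq> Pow X" using assms(1) by (auto simp: up_set_def)
qed (use assms up_setD in auto)

text \<open>The arithmetic of splitting along one coordinate: index 0 counts the sets without the
  new element, index 1 the sets with it. Writing \<open>q = (g1 - g0) * (u1 - u0)\<close>, the
  product of the sums is twice the sum of the products minus \<open>q\<close>. For even
  \<open>g0 + g1\<close>, the nonnegative parity terms are dropped and \<open>0 \<le> q\<close>
  suffices.\<close>

lemma kleitman_odd_step:
  fixes g0 g1 u0 u1 i0 i1 N :: int
  assumes "g0 * u0 + (if odd g0 then min u0 (N - u0) else 0) \<le> N * i0"
    and "g1 * u1 + (if odd g1 then min u1 (N - u1) else 0) \<le> N * i1"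
    and "g0 \<le> g1" "u0 \<le> u1" "0 \<le> u0" "u1 \<le> N"
  shows "(g0 + g1) * (u0 + u1) +
           (if odd (g0 + g1) then min (u0 + u1) (2 * N - (u0 + u1)) else 0) \<le> 2 * N * (i0 + i1)"
proof -
  define q where "q = (g1 - g0) * (u1 - u0)"
  have eq: "(g0 + g1) * (u0 + u1) = 2 * (g0 * u0) + 2 * (g1 * u1) - q"
    by (simp add: q_def algebra_simps)
  have dist: "2 * N * (i0 + i1) = 2 * (N * i0) + 2 * (N * i1)"
    by (simp add: algebra_simps)
  show ?thesis
  proof (cases "odd (g0 + g1)")
    case True
    \<comment> \<open>Exactly one of \<open>g0\<close>, \<open>g1\<close> is odd, so they differ and
      \<open>q\<close> is at least \<open>u1 - u0\<close>. Together with twice the parity term of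
      the odd one, this covers the new parity term.\<close>
    then have "1 \<le> g1 - g0" using assms(3) by (cases "g0 = g1") auto
    then have "1 * (u1 - u0) \<le> q"
      unfolding q_def using assms(4) by (intro mult_right_mono) auto
    then show ?thesis
      using assms eq dist True by (cases "odd g0") (auto simp: min_def split: if_splits)
  next
    case False
    have "0 \<le> q" using assms(3,4) by (simp add: q_def)
    moreover have "g0 * u0 \<le> N * i0" "g1 * u1 \<le> N * i1"
      using assms by (auto simp: min_def split: if_splits)
    ultimately show ?thesis
      using eq dist False by simp
  qed
qed

text \<open>Kleitman's correlation inequality, sharpened for odd \<open>card G\<close>. The parity
  term survives the induction because the two halves of an odd up-set have different sizes in every
  coordinate direction; over the empty ground set it is 0.\<close>

lemma kleitman_odd:
  assumes "finite X" "up_set X G" "up_set X U"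
  shows "int (card G) * int (card U) +
           (if odd (card G) then min (int (card U)) (2 ^ card X - int (card U)) else 0)
         \<le> 2 ^ card X * int (card (G \<inter> U))"
  using assms
proof (induction X arbitrary: G U rule: finite_induct)
  case empty
  then have "G = {} \<or> G = {{}}" "U = {} \<or> U = {{}}"
    by (auto simp: up_set_def subset_singleton_iff)
  then show ?case by auto
next
  case (insert x X)
  \<comment> \<open>The members of \<open>S\<close> containing \<open>x\<close>, with
    \<open>x\<close> removed. Adding \<open>x\<close> stays inside an up-set, so the link contains
    the half without \<open>x\<close>; this gives the monotonicity needed in the arithmetic
    step.\<close>
  define link where "link S = {A \<in> Pow X. insert x A \<in> S}" for S
  have fin: "finite (Pow X)" using insert.hyps by simp
  have split: "card S = card (S \<inter> Pow X) + card (link S)" if "up_set (insert x X) S" for S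
    unfolding link_def using card_split_element insert.hyps that by (auto simp: up_set_def)
  have up: "up_set X (S \<inter> Pow X)" "up_set X (link S)" "S \<inter> Pow X \<subseteq> link S"
    if S: "up_set (insert x X) S" for S
  proof -
    have mono: "B \<in> S" if "A \<in> S" "A \<subseteq> B" "B \<subseteq> insert x X" for A B
      using S that unfolding up_set_def by blast
    show "up_set X (S \<inter> Pow X)"
      unfolding up_set_def using mono by blast
    show "up_set X (link S)"
      unfolding up_set_def link_def
      by (auto intro: mono[OF _ insert_mono])
    show "S \<inter> Pow X \<subseteq> link S"
      unfolding link_def by (auto intro: mono)
  qed
  have le: "card (S \<inter> Pow X) \<le> card (link S)" if "up_set (insert x X) S" for S
    using up(3)[OF that] fin by (intro card_mono) (auto simp: link_def)
  have "card (link U) \<le> card (Pow X)"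
    using fin by (intro card_mono) (auto simp: link_def)
  then have "int (card (link U)) \<le> int (2 ^ card X)"
    unfolding of_nat_le_iff using insert.hyps by (simp add: card_Pow)
  then have bound: "int (card (link U)) \<le> 2 ^ card X" by simp
  have "up_set (insert x X) (G \<inter> U)"
    by (rule up_set_Int) (rule insert.prems)+
  note inter = split[OF this]
  have "(G \<inter> U) \<inter> Pow X = (G \<inter> Pow X) \<inter> (U \<inter> Pow X)" "link (G \<inter> U) = link G \<inter> link U"
    by (auto simp: link_def)
  note inter = inter[unfolded this]
  note step = kleitman_odd_step[of "int (card (G \<inter> Pow X))" "int (card (U \<inter> Pow X))" "2 ^ card X"
      "int (card ((G \<inter> Pow X) \<inter> (U \<inter> Pow X)))" "int (card (link G))" "int (card (link U))"
      "int (card (link G \<inter> link U))"]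
  have "(int (card (G \<inter> Pow X)) + int (card (link G))) * (int (card (U \<inter> Pow X)) + int (card (link U))) +
      (if odd (int (card (G \<inter> Pow X)) + int (card (link G)))
       then min (int (card (U \<inter> Pow X)) + int (card (link U)))
                (2 * 2 ^ card X - (int (card (U \<inter> Pow X)) + int (card (link U)))) else 0)
      \<le> 2 * 2 ^ card X * (int (card ((G \<inter> Pow X) \<inter> (U \<inter> Pow X))) + int (card (link G \<inter> link U)))"
  proof (rule step)
    show "int (card (U \<inter> Pow X)) \<le> int (card (link U))" "int (card (G \<inter> Pow X)) \<le> int (card (link G))"
      using le insert.prems by simp_all
  qed (use insert.IH[OF up(1) up(1)] insert.IH[OF up(2) up(2)] insert.prems bound in simp_all)
  then show ?case
    using split[OF insert.prems(1)] split[OF insert.prems(2)] inter insert.hyps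
    by (simp split: if_splits)
qed

text \<open>Build \<open>C\<close> from the top, each time adding a maximal element of what remains:
  everything strictly above it is already in \<open>C\<close>.\<close>

lemma exists_upward_closed_subfamily:
  fixes P :: "'a::order set"
  assumes "finite P" "c \<le> card P"
  shows "\<exists>C \<subseteq> P. card C = c \<and> (\<forall>a\<in>C. \<forall>b\<in>P. a \<le> b \<longrightarrow> b \<in> C)"
  using assms(2)
proof (induction c)
  case 0
  then show ?case by (intro exI[of _ "{}"]) auto
next
  case (Suc c)
  then obtain C where C: "C \<subseteq> P" "card C = c" "\<forall>a\<in>C. \<forall>b\<in>P. a \<le> b \<longrightarrow> b \<in> C"
    by auto
  then have "P - C \<noteq> {}" using Suc.prems by auto
  then obtain m where m: "m \<in> P - C" "\<forall>b\<in>P - C. m \<le> b \<longrightarrow> m = b"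
    using finite_has_maximal[of "P - C"] assms(1) by auto
  have "finite C" using C(1) assms(1) finite_subset by blast
  then show ?case
    using C m by (intro exI[of _ "insert m C"]) auto
qed

section \<open>The kernel map of a union-closed family and its fibres\<close>

definition kernel :: "'a set set \<Rightarrow> 'a set \<Rightarrow> 'a set" where
  "kernel F Y = \<Union>{A \<in> F. A \<subseteq> Y}"

lemma kernel_mono: "Y \<subseteq> Z \<Longrightarrow> kernel F Y \<subseteq> kernel F Z"
  by (auto simp: kernel_def)

lemma kernel_fixed: "A \<in> F \<Longrightarrow> kernel F A = A"
  by (auto simp: kernel_def)

lemma subset_kernel_iff: "A \<in> F \<Longrightarrow> A \<subseteq> kernel F Y \<longleftrightarrow> A \<subseteq> Y"
  by (auto simp: kernel_def)

text \<open>A kernel determines which members of \<open>F\<close> lie in the set, and a member lies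
  in \<open>Y \<inter> Z\<close> iff it lies in both. Hence deleting the same elements from two sets
  of one fibre leaves them in a common fibre.\<close>

lemma kernel_Int_cong:
  assumes "kernel F Y = kernel F Y'"
  shows "kernel F (Y \<inter> Z) = kernel F (Y' \<inter> Z)"
proof -
  have "{A \<in> F. A \<subseteq> Y \<inter> Z} = {A \<in> F. A \<subseteq> Y' \<inter> Z}"
    using assms subset_kernel_iff by (metis (no_types, lifting) le_inf_iff)
  then show ?thesis by (simp add: kernel_def)
qed

lemma union_closed_Union:
  assumes "union_closed F" "finite S" "S \<noteq> {}" "S \<subseteq> F"
  shows "\<Union>S \<in> F"
  using assms(2-4)
  by (induction S rule: finite_ne_induct) (use assms(1) in \<open>auto simp: union_closed_def\<close>)

lemma kernel_in:
  assumes "union_closed F" "finite F" "{} \<in> F"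
  shows "kernel F Y \<in> F"
  unfolding kernel_def using assms by (intro union_closed_Union) auto

text \<open>Binary codes are additive over disjoint unions, which permits an exchange argument for
  upward closure, and injective on finite sets, so no fibre has two maximisers.\<close>

lemma exists_up_set_transversal:
  fixes F :: "nat set set"
  assumes "finite X" "F \<subseteq> Pow X" "union_closed F" "{} \<in> F"
  shows "\<exists>G. up_set X G \<and> bij_betw (kernel F) G F"
proof -
  have finF: "finite F" using assms(1,2) finite_subset by auto
  define G where
    "G = {Y \<in> Pow X. \<forall>Z \<in> Pow X. kernel F Z = kernel F Y \<longrightarrow> set_encode Z \<le> set_encode Y}"
  have enc: "set_encode (A \<union> B) = set_encode A + set_encode B"
    if "finite A" "finite B" "A \<inter> B = {}" for A B
    using that by (simp add: set_encode_def sum.union_disjoint)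
  have "up_set X G"
    unfolding up_set_def
  proof (intro conjI ballI allI impI)
    show "G \<subseteq> Pow X" by (auto simp: G_def)
    fix g h assume g: "g \<in> G" and gh: "g \<subseteq> h \<and> h \<subseteq> X"
    have finh: "finite h" using gh assms(1) finite_subset by blast
    have "set_encode h' \<le> set_encode h" if h': "h' \<in> Pow X" "kernel F h' = kernel F h" for h'
    proof -
      \<comment> \<open>Deleting \<open>h - g\<close> turns \<open>h\<close> into \<open>g\<close>
        and \<open>h'\<close> into a set of the same fibre as \<open>g\<close>, whose code is at
        most that of \<open>g\<close>. The part deleted from \<open>h'\<close> lies in
        \<open>h - g\<close>, so it contributes no more than \<open>h - g\<close> does.\<close>
      let ?Z = "X - (h - g)"
      have finh': "finite h'" using h' assms(1) finite_subset by blast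
      have "h \<inter> ?Z = g" using gh by auto
      then have "kernel F (h' \<inter> ?Z) = kernel F g"
        using kernel_Int_cong[OF h'(2)] by metis
      then have "set_encode (h' \<inter> ?Z) \<le> set_encode g"
        using g h'(1) by (auto simp: G_def)
      moreover have "set_encode (h' \<inter> (h - g)) \<le> set_encode (h - g)"
        unfolding set_encode_def using finh by (auto intro!: sum_mono2)
      moreover have "set_encode h' = set_encode (h' \<inter> ?Z) + set_encode (h' \<inter> (h - g))"
      proof -
        have "h' = (h' \<inter> ?Z) \<union> (h' \<inter> (h - g))" using h'(1) by auto
        then show ?thesis
          using enc[of "h' \<inter> ?Z" "h' \<inter> (h - g)"] finh' by auto
      qed
      moreover have "set_encode h = set_encode g + set_encode (h - g)"
        using enc[of g "h - g"] gh finh finite_subset by (metis Diff_disjoint Diff_partition finite_Diff)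
      ultimately show ?thesis by linarith
    qed
    then show "h \<in> G" using gh by (auto simp: G_def)
  qed
  moreover have "bij_betw (kernel F) G F"
    unfolding bij_betw_def
  proof (intro conjI equalityI subsetI)
    show "inj_on (kernel F) G"
    proof (rule inj_onI)
      fix Y Z assume YZ: "Y \<in> G" "Z \<in> G" "kernel F Y = kernel F Z"
      then have "finite Y" "finite Z" using assms(1) finite_subset by (auto simp: G_def)
      moreover have "set_encode Y = set_encode Z"
        using YZ by (auto simp: G_def intro: order_antisym)
      ultimately show "Y = Z" by (simp add: set_encode_eq)
    qed
    show "A \<in> F" if "A \<in> kernel F ` G" for A
      using that kernel_in[OF assms(3) finF assms(4)] by auto
    fix A assume A: "A \<in> F"
    let ?S = "{Y \<in> Pow X. kernel F Y = A}"
    have "A \<in> ?S" using A assms(2) by (auto simp: kernel_fixed)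
    then have "?S \<noteq> {}" by blast
    have "finite ?S" using assms(1) by simp
    obtain Y where Y: "Y \<in> ?S" "Max (set_encode ` ?S) = set_encode Y"
      by (rule obtains_MAX[OF \<open>finite ?S\<close> \<open>?S \<noteq> {}\<close>])
    have "set_encode Z \<le> set_encode Y" if "Z \<in> ?S" for Z
      unfolding Y(2)[symmetric] using \<open>finite ?S\<close> that by (intro Max_ge) auto
    with Y(1) have "Y \<in> G" "kernel F Y = A" by (simp_all add: G_def)
    then show "A \<in> kernel F ` G" by blast
  qed
  ultimately show ?thesis by blast
qed

theorem theorem3p7:
  fixes n :: nat and F :: "nat set set"
  assumes "F \<subseteq> Pow {1..n}"
    and "nontrivial F"
    and "union_closed F"
  shows "\<exists>U. up_set {1..n} U \<and> card U \<le> 2 ^ (n - 1) \<and>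
           real (card (F \<inter> U)) \<ge> 1 / 2 * real (card F)"
proof -
  let ?X = "{1..n}"
  \<comment> \<open>Adjoining the empty set ensures that every \<open>Y\<close> has its kernel in
    the family.\<close>
  define F' where "F' = insert {} F"
  have F': "F' \<subseteq> Pow ?X" "union_closed F'" "{} \<in> F'"
    using assms(1,3) by (auto simp: F'_def union_closed_def)
  have finF': "finite F'" using F'(1) finite_subset by auto
  obtain A where A: "A \<in> F" "A \<noteq> {}" using assms(2) by (auto simp: nontrivial_def)
  have "card {{}, A} \<le> card F'"
    using A finF' by (intro card_mono) (auto simp: F'_def)
  then have two: "2 \<le> card F'" using A(2) by simp
  \<comment> \<open>Positivity of \<open>n\<close> rules out truncation in \<open>n - 1\<close>, so
    \<open>2 ^ (n - 1)\<close> really is half of \<open>2 ^ n\<close>.\<close>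
  have "n \<noteq> 0" using A assms(1) by auto
  then have pow: "(2::int) ^ n = 2 * 2 ^ (n - 1)"
    by (simp flip: power_Suc)
  \<comment> \<open>Half of \<open>card F'\<close>, rounded up, so that \<open>2 * c\<close> is at
    least \<open>card F\<close>.\<close>
  define c where "c = (card F' + 1) div 2"
  have "c \<le> card F'" using two by (simp add: c_def)
  then obtain C where C: "C \<subseteq> F'" "card C = c" "\<forall>a\<in>C. \<forall>b\<in>F'. a \<subseteq> b \<longrightarrow> b \<in> C"
    using exists_upward_closed_subfamily[OF finF'] by metis
  \<comment> \<open>The empty set lies below everything, so its presence would force
    \<open>C = F'\<close>, while \<open>c < card F'\<close> as \<open>card F'\<close> is at least 2.
    Thus all of \<open>C\<close> counts towards \<open>F\<close> itself.\<close>
  have "{} \<notin> C"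
  proof
    assume "{} \<in> C"
    then have "C = F'" using C by auto
    then show False using C(2) two by (simp add: c_def)
  qed
  then have "C \<subseteq> F" using C(1) by (auto simp: F'_def)
  define U where "U = {Y \<in> Pow ?X. kernel F' Y \<in> C}"
  have up: "up_set ?X U"
  proof (rule up_setI)
    fix Y Z assume YZ: "Y \<in> U" "Y \<subseteq> Z" "Z \<subseteq> ?X"
    then have "kernel F' Y \<in> C" by (simp add: U_def)
    then have "kernel F' Z \<in> C"
      by (rule C(3)[rule_format, OF _ kernel_in[OF F'(2) finF' F'(3)] kernel_mono[OF YZ(2)]])
    then show "Z \<in> U" using YZ(3) by (simp add: U_def)
  qed (auto simp: U_def)
  have "C \<subseteq> F \<inter> U"
    using \<open>C \<subseteq> F\<close> F'(1) C(1) by (auto simp: U_def kernel_fixed subset_iff)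
  then have "c \<le> card (F \<inter> U)"
    using C(2) finF' by (metis F'_def card_mono finite_Int finite_insert)
  moreover have "card F \<le> card F'"
    using finF' by (intro card_mono) (auto simp: F'_def)
  ultimately have "card F \<le> 2 * card (F \<inter> U)" by (simp add: c_def)
  then have half: "real (card (F \<inter> U)) \<ge> 1 / 2 * real (card F)" by linarith
  obtain G where G: "up_set ?X G" "bij_betw (kernel F') G F'"
    using exists_up_set_transversal[OF _ F'] by auto
  have cardG: "card G = card F'" using G(2) by (rule bij_betw_same_card)
  \<comment> \<open>Within \<open>Pow ?X\<close>, \<open>U\<close> is the preimage of
    \<open>C\<close>, so the bijection from \<open>G\<close> to \<open>F'\<close> restricts.\<close>
  have "bij_betw (kernel F') (G \<inter> U) C"
  proof -
    have "G \<subseteq> Pow ?X" using G(1) by (simp add: up_set_def)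
    then have "G \<inter> U = {Y \<in> G. kernel F' Y \<in> C}" by (auto simp: U_def)
    moreover have "kernel F' ` {Y \<in> G. kernel F' Y \<in> C} = C"
    proof (intro equalityI subsetI)
      fix c assume "c \<in> C"
      then have "c \<in> kernel F' ` G" using bij_betw_imp_surj_on[OF G(2)] C(1) by auto
      then show "c \<in> kernel F' ` {Y \<in> G. kernel F' Y \<in> C}" using \<open>c \<in> C\<close> by auto
    qed auto
    ultimately show ?thesis
      using G(2) by (auto simp: bij_betw_def intro: inj_on_subset)
  qed
  then have cardGU: "card (G \<inter> U) = c" using C(2) bij_betw_same_card by blast
  have kle: "int (card F') * int (card U) +
      (if odd (card F') then min (int (card U)) (2 ^ n - int (card U)) else 0) \<le> 2 ^ n * int c"
    using kleitman_odd[OF _ G(1) up] by (simp add: cardG cardGU split: if_splits)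
  have "int (card U) \<le> 2 ^ (n - 1)"
  proof (rule ccontr)
    assume "\<not> ?thesis"
    then have big: "2 ^ (n - 1) < int (card U)" by simp
    show False
    proof (cases "odd (card F')")
      case True
      then obtain m where m: "card F' = 2 * m + 1" by (elim oddE)
      then have "m > 0" "c = m + 1" using two by (auto simp: c_def)
      \<comment> \<open>As \<open>card U\<close> exceeds \<open>2 ^ (n - 1)\<close>, the minimum is
        \<open>2 ^ n - card U\<close>. Its \<open>2 ^ n\<close> cancels the excess from rounding
        \<open>c\<close> up to \<open>m + 1\<close>, and its \<open>- card U\<close> reduces the
        factor \<open>2 * m + 1\<close> to \<open>2 * m\<close>.\<close>
      then have "2 * int m * int (card U) \<le> 2 * int m * 2 ^ (n - 1)"
        using kle m big pow by (simp add: algebra_simps)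
      then show False using big \<open>m > 0\<close> by simp
    next
      case False
      then obtain m where m: "card F' = 2 * m" by (auto elim: evenE)
      then have "m > 0" "c = m" using two by (auto simp: c_def)
      then have "2 * int m * int (card U) \<le> 2 * int m * 2 ^ (n - 1)"
        using kle m pow by (simp add: algebra_simps)
      then show False using big \<open>m > 0\<close> by simp
    qed
  qed
  then have "card U \<le> 2 ^ (n - 1)" by (metis of_nat_le_iff of_nat_numeral of_nat_power)
  then show ?thesis using up half by blast
qed

end
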